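(* Let $G$ be a group with identity element $e$ and let $R=\oplus_{g\in G}R_g$ be a $G$-graded ring. Then $R$ is $G$-controlled if and only if the following two conditions hold: (a) $R_g$ is a simple $R_e$-bimodule, for each $g\in G$; and (b) for all $g,h\in G$, $R_g\cong R_h$ (as $R_e$-bimodules) if and only if $g=h$.
   Context: Rings are associative and unital. For subsets $X,Y$ of a ring, $XY$ denotes the set of all finite sums of elements $xy$ with $x\in X$, $y\in Y$. A ring $R$ is $G$-graded if there are additive subgroups $R_g$ ($g\in G$) of $R$ with $R=\oplus_{g\in G}R_g$ and $R_gR_h\subseteq R_{gh}$ for all $g,h\in G$. Then $R_e$ is a subring of $R$ with $1_R\in R_e$, and each $R_g$ is an $R_e$-bimodule by multiplication in $R$. For $H\subseteq G$ put $R_H=\oplus_{h\in H}R_h$, with $R_\varnothing=\{0\}$; it is an $R_e$-bimodule. Simple bimodules are by definition non-zero. The $G$-graded ring $R$ is called $G$-controlled if, for the given gradation: (1) the map $H\mapsto R_H=\oplus_{h\in H}R_h$ from the power set of $G$ to the set of all $R_e$-bimodules contained in $R$ (with scalar multiplication coming from the multiplication of $R$) is a bijection; and (2) for $S,T\subseteq G$, $R_S\cong R_T$ as $R_e$-bimodules if and only if $S=T$. *)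

theory Defs
  imports "HOL-Algebra.AbelCoset"
begin

text \<open>The product \<open>X Y\<close> of two subsets of a ring: all finite sums of elements \<open>x y\<close>.\<close>

definition prod_sums :: "('a, 'n) ring_scheme \<Rightarrow> 'a set \<Rightarrow> 'a set \<Rightarrow> 'a set" where
  "prod_sums R X Y =
     {finsum R (\<lambda>i. x i \<otimes>\<^bsub>R\<^esub> y i) {..<n} | (n::nat) x y. x \<in> {..<n} \<rightarrow> X \<and> y \<in> {..<n} \<rightarrow> Y}"

text \<open>
  The external direct sum \<open>fin_supp_families R A H\<close> consists of the finitely supported families
  \<open>(c h)\<close>, indexed by \<open>h \<in> H\<close>, with \<open>c h \<in> A h\<close>. A family is summed over its support, because
  \<^const>\<open>finsum\<close> over an infinite index set is zero by convention.
\<close>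

definition fin_supp_families ::
    "('a, 'n) ring_scheme \<Rightarrow> ('g \<Rightarrow> 'a set) \<Rightarrow> 'g set \<Rightarrow> ('g \<Rightarrow> 'a) set" where
  "fin_supp_families R A H = {c \<in> \<Pi>\<^sub>E h\<in>H. A h. finite {h \<in> H. c h \<noteq> \<zero>\<^bsub>R\<^esub>}}"

definition family_sum :: "('a, 'n) ring_scheme \<Rightarrow> 'g set \<Rightarrow> ('g \<Rightarrow> 'a) \<Rightarrow> 'a" where
  "family_sum R H c = finsum R c {h \<in> H. c h \<noteq> \<zero>\<^bsub>R\<^esub>}"

text \<open>\<open>graded_part R A H\<close> is the subset \<open>R\<^sub>H\<close> of \<open>R\<close>; it is \<open>{0}\<close> for empty \<open>H\<close>.\<close>

definition graded_part :: "('a, 'n) ring_scheme \<Rightarrow> ('g \<Rightarrow> 'a set) \<Rightarrow> 'g set \<Rightarrow> 'a set" where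
  "graded_part R A H = family_sum R H ` fin_supp_families R A H"

text \<open>
  \<open>A g\<close> is the homogeneous component \<open>R\<^sub>g\<close>. The assumption \<open>direct_sum\<close> says that every element
  of \<open>R\<close> is the sum of exactly one finitely supported family of homogeneous elements.
\<close>

locale graded_ring = group G + R: ring R
  for G :: "('g, 'm) monoid_scheme" (structure)
    and R :: "('a, 'n) ring_scheme"
    and A :: "'g \<Rightarrow> 'a set" +
  assumes component_subgroup: "g \<in> carrier G \<Longrightarrow> additive_subgroup (A g) R"
    and direct_sum:
      "bij_betw (family_sum R (carrier G)) (fin_supp_families R A (carrier G)) (carrier R)"
    and component_mult:
      "\<lbrakk>g \<in> carrier G; h \<in> carrier G\<rbrakk> \<Longrightarrow> prod_sums R (A g) (A h) \<subseteq> A (g \<otimes> h)"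

text \<open>
  \<open>sub_bimodule R S M\<close>: \<open>M\<close> is an \<open>S\<close>-bimodule contained in \<open>R\<close>, where \<open>S\<close> is (the carrier of) a
  unital subring of \<open>R\<close> and both scalar multiplications are the multiplication of \<open>R\<close>. The
  associativity, distributivity and unit laws of a bimodule are then inherited from \<open>R\<close>.
\<close>

definition sub_bimodule :: "('a, 'n) ring_scheme \<Rightarrow> 'a set \<Rightarrow> 'a set \<Rightarrow> bool" where
  "sub_bimodule R S M \<longleftrightarrow>
     additive_subgroup M R \<and>
     (\<forall>r\<in>S. \<forall>m\<in>M. r \<otimes>\<^bsub>R\<^esub> m \<in> M \<and> m \<otimes>\<^bsub>R\<^esub> r \<in> M)"

definition simple_bimodule :: "('a, 'n) ring_scheme \<Rightarrow> 'a set \<Rightarrow> 'a set \<Rightarrow> bool" where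
  "simple_bimodule R S M \<longleftrightarrow>
     sub_bimodule R S M \<and> M \<noteq> {\<zero>\<^bsub>R\<^esub>} \<and>
     (\<forall>N. sub_bimodule R S N \<and> N \<subseteq> M \<longrightarrow> N = {\<zero>\<^bsub>R\<^esub>} \<or> N = M)"

definition bimodule_isomorphic ::
    "('a, 'n) ring_scheme \<Rightarrow> 'a set \<Rightarrow> 'a set \<Rightarrow> 'a set \<Rightarrow> bool" where
  "bimodule_isomorphic R S M N \<longleftrightarrow>
     (\<exists>f. bij_betw f M N \<and>
          (\<forall>x\<in>M. \<forall>y\<in>M. f (x \<oplus>\<^bsub>R\<^esub> y) = f x \<oplus>\<^bsub>R\<^esub> f y) \<and>
          (\<forall>r\<in>S. \<forall>x\<in>M. f (r \<otimes>\<^bsub>R\<^esub> x) = r \<otimes>\<^bsub>R\<^esub> f x \<and> f (x \<otimes>\<^bsub>R\<^esub> r) = f x \<otimes>\<^bsub>R\<^esub> r))"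

definition controlled ::
    "('g, 'm) monoid_scheme \<Rightarrow> ('a, 'n) ring_scheme \<Rightarrow> ('g \<Rightarrow> 'a set) \<Rightarrow> bool" where
  "controlled G R A \<longleftrightarrow>
     bij_betw (graded_part R A) (Pow (carrier G)) {M. sub_bimodule R (A \<one>\<^bsub>G\<^esub>) M} \<and>
     (\<forall>S T. S \<subseteq> carrier G \<and> T \<subseteq> carrier G \<longrightarrow>
        (bimodule_isomorphic R (A \<one>\<^bsub>G\<^esub>) (graded_part R A S) (graded_part R A T) \<longleftrightarrow> S = T))"

end

theory Submission
  imports Defs
begin

text \<open>
  Write \<open>R\<^sub>H\<close> for \<open>graded_part R A H\<close>; all bimodules are over \<open>A \<one>\<close>. The two conditions on the
  components say that \<open>R\<close> is a multiplicity-free semisimple bimodule: a direct sum of simple,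
  pairwise non-isomorphic ones.

  That control implies the conditions is read off from singletons, since \<open>R\<^sub>H = A g\<close> for
  \<open>H = {g}\<close>. Injectivity of \<open>H \<mapsto> R\<^sub>H\<close> separates \<open>{g}\<close> from the empty set, so \<open>A g\<close> is
  non-zero. A sub-bimodule of \<open>A g\<close> is some \<open>R\<^sub>H\<close> by surjectivity; as components are non-zero,
  \<open>R\<^sub>H \<subseteq> A g\<close> forces \<open>H \<subseteq> {g}\<close>, which leaves only \<open>{0}\<close> and \<open>A g\<close>
  (\<open>controlled_imp_simple\<close>).

  The converse rests on the projections \<open>component g\<close> of \<open>R\<close> onto \<open>A g\<close>, which are bimodule
  homomorphisms, and on Schur's lemma. The key step (\<open>component_contained\<close>) is that a
  sub-bimodule \<open>N\<close> contains \<open>A g\<close> whenever some element of \<open>N\<close> has a non-zero component in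
  degree \<open>g\<close>. If \<open>x \<in> N\<close> has support \<open>F\<close> and \<open>N\<close> contains no non-zero element of smaller
  support inside \<open>F\<close>, then \<open>N \<inter> R\<^sub>F\<close> projects isomorphically onto \<open>A g\<close> for every \<open>g \<in> F\<close>; as
  distinct components are not isomorphic, \<open>F\<close> is a singleton and simplicity of the component
  applies. Otherwise an induction on the size of the support splits \<open>x\<close>. Hence
  \<open>N\<close> is \<open>R\<^sub>H\<close> for \<open>H = {g. A g \<subseteq> N}\<close>. Finally, if \<open>R\<^sub>S \<cong> R\<^sub>T\<close> and \<open>g \<in> S\<close>, then the isomorphism
  restricted to \<open>A g\<close> has a non-zero projection to some \<open>A h\<close> with \<open>h \<in> T\<close>, so \<open>A g \<cong> A h\<close> and
  \<open>g = h\<close>; by symmetry \<open>S = T\<close> (\<open>graded_part_isomorphic_imp_subset\<close>).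
\<close>

section \<open>Homomorphisms of bimodules inside a ring\<close>

definition bimodule_hom ::
    "('a, 'n) ring_scheme \<Rightarrow> 'a set \<Rightarrow> 'a set \<Rightarrow> 'a set \<Rightarrow> ('a \<Rightarrow> 'a) \<Rightarrow> bool" where
  "bimodule_hom R S M N f \<longleftrightarrow>
     f \<in> M \<rightarrow> N \<and>
     (\<forall>x\<in>M. \<forall>y\<in>M. f (x \<oplus>\<^bsub>R\<^esub> y) = f x \<oplus>\<^bsub>R\<^esub> f y) \<and>
     (\<forall>r\<in>S. \<forall>x\<in>M. f (r \<otimes>\<^bsub>R\<^esub> x) = r \<otimes>\<^bsub>R\<^esub> f x \<and> f (x \<otimes>\<^bsub>R\<^esub> r) = f x \<otimes>\<^bsub>R\<^esub> r)"

lemma bimodule_isomorphic_iff_bij_hom: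
  "bimodule_isomorphic R S M N \<longleftrightarrow> (\<exists>f. bimodule_hom R S M N f \<and> bij_betw f M N)"
  unfolding bimodule_isomorphic_def bimodule_hom_def by (auto dest: bij_betw_imp_funcset)

lemma bimodule_hom_closed: "bimodule_hom R S M N f \<Longrightarrow> x \<in> M \<Longrightarrow> f x \<in> N"
  unfolding bimodule_hom_def by blast

lemma bimodule_hom_add:
  "bimodule_hom R S M N f \<Longrightarrow> x \<in> M \<Longrightarrow> y \<in> M \<Longrightarrow> f (x \<oplus>\<^bsub>R\<^esub> y) = f x \<oplus>\<^bsub>R\<^esub> f y"
  unfolding bimodule_hom_def by blast

lemma bimodule_hom_scale:
  assumes "bimodule_hom R S M N f" "r \<in> S" "x \<in> M"
  shows "f (r \<otimes>\<^bsub>R\<^esub> x) = r \<otimes>\<^bsub>R\<^esub> f x" "f (x \<otimes>\<^bsub>R\<^esub> r) = f x \<otimes>\<^bsub>R\<^esub> r"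
  using assms unfolding bimodule_hom_def by blast+

lemma bimodule_isomorphic_refl: "bimodule_isomorphic R S M M"
  unfolding bimodule_isomorphic_def by (rule exI[of _ id]) auto

lemma bimodule_hom_comp:
  assumes "bimodule_hom R S L M f" "bimodule_hom R S M N g"
  shows "bimodule_hom R S L N (\<lambda>x. g (f x))"
  using assms unfolding bimodule_hom_def by (auto simp: Pi_iff)

lemma bimodule_hom_subset:
  assumes "bimodule_hom R S M N f" "L \<subseteq> M"
  shows "bimodule_hom R S L N f"
  using assms unfolding bimodule_hom_def by blast

lemma sub_bimoduleD:
  assumes "sub_bimodule R S M"
  shows "additive_subgroup M R"
    and "r \<in> S \<Longrightarrow> m \<in> M \<Longrightarrow> r \<otimes>\<^bsub>R\<^esub> m \<in> M"
    and "r \<in> S \<Longrightarrow> m \<in> M \<Longrightarrow> m \<otimes>\<^bsub>R\<^esub> r \<in> M"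
  using assms unfolding sub_bimodule_def by blast+

lemma bimodule_isomorphic_trans:
  assumes "bimodule_isomorphic R S L M" "bimodule_isomorphic R S M N"
  shows "bimodule_isomorphic R S L N"
proof -
  obtain f g where f: "bimodule_hom R S L M f" "bij_betw f L M"
    and g: "bimodule_hom R S M N g" "bij_betw g M N"
    using assms unfolding bimodule_isomorphic_iff_bij_hom by blast
  have "bij_betw (\<lambda>x. g (f x)) L N"
    using bij_betw_trans[OF f(2) g(2)] by (simp add: comp_def)
  then show ?thesis
    using bimodule_hom_comp[OF f(1) g(1)] unfolding bimodule_isomorphic_iff_bij_hom by blast
qed

context ring
begin

lemma sub_bimodule_memD:
  assumes "sub_bimodule R S M"
  shows "x \<in> M \<Longrightarrow> x \<in> carrier R" "\<zero> \<in> M" "x \<in> M \<Longrightarrow> y \<in> M \<Longrightarrow> x \<oplus> y \<in> M"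
    "x \<in> M \<Longrightarrow> \<ominus> x \<in> M"
proof -
  interpret additive_subgroup M R using sub_bimoduleD(1)[OF assms] .
  show "x \<in> M \<Longrightarrow> x \<in> carrier R" "\<zero> \<in> M" "x \<in> M \<Longrightarrow> y \<in> M \<Longrightarrow> x \<oplus> y \<in> M"
    using a_subset by auto
  show "x \<in> M \<Longrightarrow> \<ominus> x \<in> M"
    using subgroup.m_inv_closed[OF a_subgroup, of x] a_subset by (simp add: a_inv_def)
qed

lemma sub_bimoduleI:
  assumes "M \<subseteq> carrier R" "\<zero> \<in> M" "\<And>x y. x \<in> M \<Longrightarrow> y \<in> M \<Longrightarrow> x \<oplus> y \<in> M"
    "\<And>x. x \<in> M \<Longrightarrow> \<ominus> x \<in> M"
    "\<And>r x. r \<in> S \<Longrightarrow> x \<in> M \<Longrightarrow> r \<otimes> x \<in> M" "\<And>r x. r \<in> S \<Longrightarrow> x \<in> M \<Longrightarrow> x \<otimes> r \<in> M"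
  shows "sub_bimodule R S M"
proof -
  have "additive_subgroup M R"
    by (rule additive_subgroup.intro, rule subgroup.intro) (use assms in \<open>auto simp flip: a_inv_def\<close>)
  then show ?thesis unfolding sub_bimodule_def by (simp add: assms(5,6))
qed

lemma sub_bimodule_Int:
  assumes "sub_bimodule R S M" "sub_bimodule R S N"
  shows "sub_bimodule R S (M \<inter> N)"
  by (rule sub_bimoduleI)
    (use sub_bimodule_memD[OF assms(1)] sub_bimodule_memD[OF assms(2)]
      sub_bimoduleD[OF assms(1)] sub_bimoduleD[OF assms(2)] in auto)

lemma bimodule_isomorphic_sym:
  assumes M: "sub_bimodule R S M" and iso: "bimodule_isomorphic R S M N"
  shows "bimodule_isomorphic R S N M"
proof -
  obtain f where f: "bimodule_hom R S M N f" "bij_betw f M N"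
    using iso unfolding bimodule_isomorphic_iff_bij_hom by blast
  let ?g = "inv_into M f"
  have bij: "bij_betw ?g N M" using f(2) by (rule bij_betw_inv_into)
  have gM: "?g y \<in> M" if "y \<in> N" for y using bij that by (rule bij_betw_apply)
  have fg: "f (?g y) = y" if "y \<in> N" for y using f(2) that by (rule bij_betw_inv_into_right)
  have gf: "?g (f x) = x" if "x \<in> M" for x using f(2) that by (rule bij_betw_inv_into_left)
  note Mcl = sub_bimodule_memD(3)[OF M] sub_bimoduleD(2,3)[OF M]
  have "bimodule_hom R S N M ?g"
    unfolding bimodule_hom_def
  proof (intro conjI ballI)
    show "?g \<in> N \<rightarrow> M" using gM by blast
    show "?g (x \<oplus> y) = ?g x \<oplus> ?g y" if "x \<in> N" "y \<in> N" for x y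
      using gf[OF Mcl(1)[OF gM[OF that(1)] gM[OF that(2)]]]
        bimodule_hom_add[OF f(1) gM[OF that(1)] gM[OF that(2)]] fg that by simp
    show "?g (r \<otimes> x) = r \<otimes> ?g x" if "r \<in> S" "x \<in> N" for r x
      using gf[OF Mcl(2)[OF that(1) gM[OF that(2)]]]
        bimodule_hom_scale(1)[OF f(1) that(1) gM[OF that(2)]] fg that by simp
    show "?g (x \<otimes> r) = ?g x \<otimes> r" if "r \<in> S" "x \<in> N" for r x
      using gf[OF Mcl(3)[OF that(1) gM[OF that(2)]]]
        bimodule_hom_scale(2)[OF f(1) that(1) gM[OF that(2)]] fg that by simp
  qed
  with bij show ?thesis unfolding bimodule_isomorphic_iff_bij_hom by blast
qed

lemma bimodule_hom_zero:
  assumes M: "sub_bimodule R S M" and N: "sub_bimodule R S N" and f: "bimodule_hom R S M N f"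
  shows "f \<zero> = \<zero>"
proof -
  have c: "f \<zero> \<in> carrier R"
    using bimodule_hom_closed[OF f] sub_bimodule_memD[OF M] sub_bimodule_memD[OF N] by blast
  have "f \<zero> \<oplus> f \<zero> = f \<zero>"
    using bimodule_hom_add[OF f, of \<zero> \<zero>] sub_bimodule_memD(2)[OF M] c by simp
  then show ?thesis using add.l_cancel_one[OF c c] by blast
qed

lemma bimodule_hom_minus:
  assumes M: "sub_bimodule R S M" and N: "sub_bimodule R S N" and f: "bimodule_hom R S M N f"
    and x: "x \<in> M"
  shows "f (\<ominus> x) = \<ominus> f x"
proof -
  note m = sub_bimodule_memD[OF M] and n = sub_bimodule_memD[OF N]
  have cl: "x \<in> carrier R" "f x \<in> carrier R" "\<ominus> x \<in> M" "f (\<ominus> x) \<in> carrier R"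
    using x m(1)[OF x] m(4)[OF x] n(1)[OF bimodule_hom_closed[OF f]] by auto
  have "f (\<ominus> x) \<oplus> f x = f (\<ominus> x \<oplus> x)" using bimodule_hom_add[OF f cl(3) x] by simp
  also have "\<dots> = \<zero>" using bimodule_hom_zero[OF M N f] cl(1) by (simp add: l_neg)
  finally show ?thesis using minus_equality cl by simp
qed

lemma sub_bimodule_kernel:
  assumes S: "S \<subseteq> carrier R" and M: "sub_bimodule R S M" and N: "sub_bimodule R S N"
    and f: "bimodule_hom R S M N f"
  shows "sub_bimodule R S {x \<in> M. f x = \<zero>}"
proof (rule sub_bimoduleI)
  note m = sub_bimodule_memD[OF M]
  show "{x \<in> M. f x = \<zero>} \<subseteq> carrier R" using m by blast
  show "\<zero> \<in> {x \<in> M. f x = \<zero>}" using m(2) bimodule_hom_zero[OF M N f] by simp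
  show "x \<oplus> y \<in> {x \<in> M. f x = \<zero>}" if "x \<in> {x \<in> M. f x = \<zero>}" "y \<in> {x \<in> M. f x = \<zero>}" for x y
    using that bimodule_hom_add[OF f] m by auto
  show "\<ominus> x \<in> {x \<in> M. f x = \<zero>}" if "x \<in> {x \<in> M. f x = \<zero>}" for x
    using that bimodule_hom_minus[OF M N f] m by auto
  show "r \<otimes> x \<in> {x \<in> M. f x = \<zero>}" "x \<otimes> r \<in> {x \<in> M. f x = \<zero>}"
    if "r \<in> S" "x \<in> {x \<in> M. f x = \<zero>}" for r x
    using that bimodule_hom_scale[OF f] sub_bimoduleD[OF M] S by auto
qed

lemma sub_bimodule_image:
  assumes M: "sub_bimodule R S M" and N: "sub_bimodule R S N" and f: "bimodule_hom R S M N f"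
  shows "sub_bimodule R S (f ` M)"
proof (rule sub_bimoduleI)
  note m = sub_bimodule_memD[OF M]
  show "f ` M \<subseteq> carrier R" using sub_bimodule_memD(1)[OF N] bimodule_hom_closed[OF f] by blast
  show "\<zero> \<in> f ` M" using bimodule_hom_zero[OF M N f] m(2) by force
  show "x \<oplus> y \<in> f ` M" if "x \<in> f ` M" "y \<in> f ` M" for x y
    using that bimodule_hom_add[OF f, symmetric] m(3) by auto
  show "\<ominus> x \<in> f ` M" if "x \<in> f ` M" for x
    using that bimodule_hom_minus[OF M N f, symmetric] m(4) by auto
  show "r \<otimes> x \<in> f ` M" "x \<otimes> r \<in> f ` M" if "r \<in> S" "x \<in> f ` M" for r x
    using that bimodule_hom_scale[OF f, symmetric] sub_bimoduleD[OF M] by auto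
qed

lemma bimodule_hom_inj_on:
  assumes M: "sub_bimodule R S M" and N: "sub_bimodule R S N" and f: "bimodule_hom R S M N f"
    and ker: "\<And>x. x \<in> M \<Longrightarrow> f x = \<zero> \<Longrightarrow> x = \<zero>"
  shows "inj_on f M"
proof (rule inj_onI)
  note m = sub_bimodule_memD[OF M] and n = sub_bimodule_memD[OF N]
  fix x y assume xy: "x \<in> M" "y \<in> M" "f x = f y"
  have "f (x \<oplus> \<ominus> y) = f x \<oplus> \<ominus> f y"
    using bimodule_hom_add[OF f xy(1) m(4)[OF xy(2)]] bimodule_hom_minus[OF M N f xy(2)] by simp
  also have "\<dots> = \<zero>" using xy n(1)[OF bimodule_hom_closed[OF f xy(2)]] by (simp add: r_neg)
  finally have "x \<oplus> \<ominus> y = \<zero>" using ker[OF m(3)[OF xy(1) m(4)[OF xy(2)]]] by blast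
  then show "x = y" using minus_equality[of x "\<ominus> y"] m(1)[OF xy(1)] m(1)[OF xy(2)] by simp
qed

text \<open>
  One half of Schur's lemma: the image is a non-zero sub-bimodule of \<open>N\<close>. The source is left
  arbitrary because projections onto single components are applied to sub-bimodules that are not
  yet known to be simple.
\<close>

lemma simple_bimodule_hom_onto:
  assumes M: "sub_bimodule R S M" and N: "simple_bimodule R S N" and f: "bimodule_hom R S M N f"
    and nz: "x \<in> M" "f x \<noteq> \<zero>"
  shows "f ` M = N"
proof -
  have "sub_bimodule R S (f ` M)"
    using sub_bimodule_image M N f unfolding simple_bimodule_def by blast
  moreover have "f ` M \<subseteq> N" using bimodule_hom_closed[OF f] by blast
  moreover have "f ` M \<noteq> {\<zero>}" using nz by blast
  ultimately show ?thesis using N unfolding simple_bimodule_def by blast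
qed

text \<open>
  Schur's lemma: the kernel is a proper sub-bimodule of \<open>M\<close>, hence zero, and the image is all
  of \<open>N\<close>.
\<close>

lemma simple_bimodules_isomorphic:
  assumes S: "S \<subseteq> carrier R" and M: "simple_bimodule R S M" and N: "simple_bimodule R S N"
    and f: "bimodule_hom R S M N f" and nz: "x \<in> M" "f x \<noteq> \<zero>"
  shows "bimodule_isomorphic R S M N"
proof -
  have M': "sub_bimodule R S M" and N': "sub_bimodule R S N"
    using M N unfolding simple_bimodule_def by auto
  have "{x \<in> M. f x = \<zero>} = {\<zero>}"
    using sub_bimodule_kernel[OF S M' N' f] M nz unfolding simple_bimodule_def by blast
  then have "inj_on f M" by (intro bimodule_hom_inj_on[OF M' N' f]) blast
  then have "bij_betw f M N"
    using simple_bimodule_hom_onto[OF M' N f nz] unfolding bij_betw_def by blast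
  with f show ?thesis unfolding bimodule_isomorphic_iff_bij_hom by blast
qed

end

section \<open>Homogeneous components\<close>

context graded_ring
begin

text \<open>
  The direct sum decomposition is given as a bijection from families to elements, so the
  projection to degree \<open>g\<close> evaluates the inverse of that bijection at \<open>g\<close>.
\<close>

definition component :: "'g \<Rightarrow> 'a \<Rightarrow> 'a" where
  "component g x =
     inv_into (fin_supp_families R A (carrier G)) (family_sum R (carrier G)) x g"

definition support :: "'a \<Rightarrow> 'g set" where
  "support x = {g \<in> carrier G. component g x \<noteq> \<zero>\<^bsub>R\<^esub>}"

lemma A_carrier: "g \<in> carrier G \<Longrightarrow> x \<in> A g \<Longrightarrow> x \<in> carrier R"
  using additive_subgroup.a_subset[OF component_subgroup] by blast

lemma zero_in_A: "g \<in> carrier G \<Longrightarrow> \<zero>\<^bsub>R\<^esub> \<in> A g"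
  using additive_subgroup.zero_closed[OF component_subgroup] .

lemma homogeneous_mult:
  assumes "g \<in> carrier G" "h \<in> carrier G" "x \<in> A g" "y \<in> A h"
  shows "x \<otimes>\<^bsub>R\<^esub> y \<in> A (g \<otimes> h)"
proof -
  have "x \<otimes>\<^bsub>R\<^esub> y = finsum R (\<lambda>i. x \<otimes>\<^bsub>R\<^esub> y) {..<1::nat}"
    using A_carrier assms by (simp add: lessThan_Suc)
  also have "\<dots> \<in> prod_sums R (A g) (A h)"
    unfolding prod_sums_def mem_Collect_eq
    by (rule exI[of _ 1], rule exI[of _ "\<lambda>_. x"], rule exI[of _ "\<lambda>_. y"])
      (use assms(3,4) in simp)
  finally show ?thesis using component_mult assms by blast
qed

lemma identity_component_mult:
  assumes "g \<in> carrier G" "r \<in> A \<one>" "x \<in> A g"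
  shows "r \<otimes>\<^bsub>R\<^esub> x \<in> A g" "x \<otimes>\<^bsub>R\<^esub> r \<in> A g"
  using homogeneous_mult[of \<one> g r x] homogeneous_mult[of g \<one> x r] assms by auto

lemma sub_bimodule_A: "g \<in> carrier G \<Longrightarrow> sub_bimodule R (A \<one>) (A g)"
  unfolding sub_bimodule_def using component_subgroup identity_component_mult by blast

lemma component_family:
  assumes "x \<in> carrier R"
  shows "(\<lambda>g. component g x) \<in> fin_supp_families R A (carrier G)"
    and "family_sum R (carrier G) (\<lambda>g. component g x) = x"
  using bij_betw_apply[OF bij_betw_inv_into[OF direct_sum] assms]
    bij_betw_inv_into_right[OF direct_sum assms]
  unfolding component_def by simp_all

lemma component_in_A: "g \<in> carrier G \<Longrightarrow> x \<in> carrier R \<Longrightarrow> component g x \<in> A g"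
  using component_family(1) unfolding fin_supp_families_def by blast

lemma component_carrier: "g \<in> carrier G \<Longrightarrow> x \<in> carrier R \<Longrightarrow> component g x \<in> carrier R"
  using component_in_A A_carrier by blast

lemma finite_support: "x \<in> carrier R \<Longrightarrow> finite (support x)"
  using component_family(1) unfolding fin_supp_families_def support_def by blast

lemma support_subset: "support x \<subseteq> carrier G"
  unfolding support_def by blast

lemma finsum_components:
  "x \<in> carrier R \<Longrightarrow> finsum R (\<lambda>g. component g x) (support x) = x"
  using component_family(2) unfolding family_sum_def support_def by blast

text \<open>
  Uniqueness of the decomposition, in the form in which all later computations use it: extending
  \<open>c\<close> by zero gives a finitely supported family with sum \<open>finsum R c F\<close>, so it is the family of
  components of that sum. To compute the components of an expression, it thus suffices to rewrite
  the expression as a finite sum of homogeneous elements.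
\<close>

lemma component_finsum:
  assumes F: "finite F" "F \<subseteq> carrier G" and c: "\<And>h. h \<in> F \<Longrightarrow> c h \<in> A h"
    and g: "g \<in> carrier G"
  shows "component g (finsum R c F) = (if g \<in> F then c g else \<zero>\<^bsub>R\<^esub>)"
proof -
  \<comment> \<open>Families are extensional functions, hence the value \<open>undefined\<close> outside \<open>carrier G\<close>.\<close>
  let ?d = "\<lambda>h. if h \<in> carrier G then if h \<in> F then c h else \<zero>\<^bsub>R\<^esub> else undefined"
  have cR: "c h \<in> carrier R" if "h \<in> F" for h using c F A_carrier that by blast
  have sub: "{h \<in> carrier G. ?d h \<noteq> \<zero>\<^bsub>R\<^esub>} \<subseteq> F" by auto
  have d: "?d \<in> fin_supp_families R A (carrier G)"
    unfolding fin_supp_families_def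
    using c zero_in_A finite_subset[OF sub F(1)] by (auto simp: PiE_def extensional_def)
  have "family_sum R (carrier G) ?d = finsum R ?d F"
    unfolding family_sum_def
    by (rule R.add.finprod_mono_neutral_cong_left) (use F sub cR in auto)
  also have "\<dots> = finsum R c F"
    by (rule R.add.finprod_cong') (use F cR in auto)
  finally have "inv_into (fin_supp_families R A (carrier G)) (family_sum R (carrier G)) (finsum R c F) = ?d"
    using bij_betw_inv_into_left[OF direct_sum d] by simp
  then show ?thesis unfolding component_def using g by simp
qed

lemma finsum_components_superset:
  assumes "x \<in> carrier R" "finite F" "support x \<subseteq> F" "F \<subseteq> carrier G"
  shows "finsum R (\<lambda>g. component g x) F = x"
proof -
  have "finsum R (\<lambda>g. component g x) (support x) = finsum R (\<lambda>g. component g x) F"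
    by (rule R.add.finprod_mono_neutral_cong_left)
      (use assms component_carrier in \<open>auto simp: support_def\<close>)
  then show ?thesis using finsum_components assms by simp
qed

lemma component_homogeneous:
  assumes "g \<in> carrier G" "h \<in> carrier G" "x \<in> A h"
  shows "component g x = (if g = h then x else \<zero>\<^bsub>R\<^esub>)"
  using component_finsum[of "{h}" "\<lambda>_. x" g] assms A_carrier by simp

text \<open>
  Additivity and linearity over \<open>A \<one>\<close> hold because both operations can be carried out termwise
  without leaving the components; for scalars this is \<open>A \<one> A g \<subseteq> A g\<close>.
\<close>

lemma component_add:
  assumes g: "g \<in> carrier G" and x: "x \<in> carrier R" and y: "y \<in> carrier R"
  shows "component g (x \<oplus>\<^bsub>R\<^esub> y) = component g x \<oplus>\<^bsub>R\<^esub> component g y"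
proof -
  \<comment> \<open>The degree \<open>g\<close> is included so that \<open>component_finsum\<close> falls into its first case.\<close>
  let ?F = "insert g (support x \<union> support y)"
  have F: "finite ?F" "?F \<subseteq> carrier G" using finite_support support_subset g x y by auto
  have "finsum R (\<lambda>h. component h x) ?F = x" "finsum R (\<lambda>h. component h y) ?F = y"
    by (rule finsum_components_superset[OF x F(1) _ F(2)], blast,
        rule finsum_components_superset[OF y F(1) _ F(2)], blast)
  then have "x \<oplus>\<^bsub>R\<^esub> y =
      finsum R (\<lambda>h. component h x) ?F \<oplus>\<^bsub>R\<^esub> finsum R (\<lambda>h. component h y) ?F"
    by simp
  also have "\<dots> = finsum R (\<lambda>h. component h x \<oplus>\<^bsub>R\<^esub> component h y) ?F"
    by (rule R.finsum_addf[symmetric]) (use F x y component_carrier in auto)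
  finally have "component g (x \<oplus>\<^bsub>R\<^esub> y) =
      component g (finsum R (\<lambda>h. component h x \<oplus>\<^bsub>R\<^esub> component h y) ?F)" by simp
  also have "\<dots> = (if g \<in> ?F then component g x \<oplus>\<^bsub>R\<^esub> component g y else \<zero>\<^bsub>R\<^esub>)"
  proof (rule component_finsum[OF F _ g])
    fix h assume "h \<in> ?F"
    then have h: "h \<in> carrier G" using F(2) by blast
    show "component h x \<oplus>\<^bsub>R\<^esub> component h y \<in> A h"
      by (rule R.sub_bimodule_memD(3)[OF sub_bimodule_A[OF h]
            component_in_A[OF h x] component_in_A[OF h y]])
  qed
  finally show ?thesis by simp
qed

lemma component_scale:
  assumes g: "g \<in> carrier G" and r: "r \<in> A \<one>" and x: "x \<in> carrier R"
  shows "component g (r \<otimes>\<^bsub>R\<^esub> x) = r \<otimes>\<^bsub>R\<^esub> component g x"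
    and "component g (x \<otimes>\<^bsub>R\<^esub> r) = component g x \<otimes>\<^bsub>R\<^esub> r"
proof -
  let ?F = "insert g (support x)"
  have F: "finite ?F" "?F \<subseteq> carrier G" using finite_support support_subset g x by auto
  have rR: "r \<in> carrier R" using r A_carrier by blast
  have sum: "finsum R (\<lambda>h. component h x) ?F = x"
    using finsum_components_superset[OF x F(1) _ F(2)] by auto
  have cR: "(\<lambda>h. component h x) \<in> ?F \<rightarrow> carrier R" using F x component_carrier by blast
  have AF: "component h x \<in> A h" "h \<in> carrier G" if "h \<in> ?F" for h
    using that F(2) component_in_A[OF _ x] by auto
  have "r \<otimes>\<^bsub>R\<^esub> x = finsum R (\<lambda>h. r \<otimes>\<^bsub>R\<^esub> component h x) ?F"
    using R.finsum_rdistr[OF F(1) rR cR] sum by simp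
  then show "component g (r \<otimes>\<^bsub>R\<^esub> x) = r \<otimes>\<^bsub>R\<^esub> component g x"
    using component_finsum[OF F identity_component_mult(1)[OF AF(2) r AF(1)] g] by simp
  have "x \<otimes>\<^bsub>R\<^esub> r = finsum R (\<lambda>h. component h x \<otimes>\<^bsub>R\<^esub> r) ?F"
    using R.finsum_ldistr[OF F(1) rR cR] sum by simp
  then show "component g (x \<otimes>\<^bsub>R\<^esub> r) = component g x \<otimes>\<^bsub>R\<^esub> r"
    using component_finsum[OF F identity_component_mult(2)[OF AF(2) r AF(1)] g] by simp
qed

lemma A_one_subset: "A \<one> \<subseteq> carrier R"
  using A_carrier by blast

lemma sub_bimodule_carrier: "sub_bimodule R (A \<one>) (carrier R)"
  by (rule R.sub_bimoduleI) (use A_one_subset in auto)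

lemma component_hom:
  assumes "g \<in> carrier G"
  shows "bimodule_hom R (A \<one>) (carrier R) (A g) (component g)"
  unfolding bimodule_hom_def
  using component_in_A component_add component_scale assms by auto

lemma component_zero: "g \<in> carrier G \<Longrightarrow> component g \<zero>\<^bsub>R\<^esub> = \<zero>\<^bsub>R\<^esub>"
  using R.bimodule_hom_zero[OF sub_bimodule_carrier sub_bimodule_A component_hom] .

lemma component_minus:
  "g \<in> carrier G \<Longrightarrow> x \<in> carrier R \<Longrightarrow> component g (\<ominus>\<^bsub>R\<^esub> x) = \<ominus>\<^bsub>R\<^esub> component g x"
  using R.bimodule_hom_minus[OF sub_bimodule_carrier sub_bimodule_A component_hom] .

lemma support_empty_iff:
  assumes "x \<in> carrier R"
  shows "support x = {} \<longleftrightarrow> x = \<zero>\<^bsub>R\<^esub>"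
  using finsum_components[OF assms] component_zero unfolding support_def by fastforce

text \<open>
  Describing \<open>R\<^sub>H\<close> by vanishing of components replaces families indexed by different sets \<open>H\<close> by
  conditions on elements of \<open>R\<close>.
\<close>

lemma graded_part_eq:
  assumes H: "H \<subseteq> carrier G"
  shows "graded_part R A H = {x \<in> carrier R. support x \<subseteq> H}"
proof (intro equalityI subsetI)
  fix x assume "x \<in> graded_part R A H"
  then obtain c where c: "c \<in> fin_supp_families R A H"
    and x: "x = finsum R c {h \<in> H. c h \<noteq> \<zero>\<^bsub>R\<^esub>}"
    unfolding graded_part_def family_sum_def by blast
  let ?F = "{h \<in> H. c h \<noteq> \<zero>\<^bsub>R\<^esub>}"
  have F: "finite ?F" "?F \<subseteq> carrier G" and cA: "\<And>h. h \<in> ?F \<Longrightarrow> c h \<in> A h"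
    using c H unfolding fin_supp_families_def by auto
  have "x \<in> carrier R"
    unfolding x by (rule R.finsum_closed) (use F(2) cA A_carrier in blast)
  moreover have "support x \<subseteq> H"
    using component_finsum[OF F cA] unfolding support_def x by (auto split: if_splits)
  ultimately show "x \<in> {x \<in> carrier R. support x \<subseteq> H}" by blast
next
  fix x assume "x \<in> {x \<in> carrier R. support x \<subseteq> H}"
  then have x: "x \<in> carrier R" "support x \<subseteq> H" by auto
  let ?c = "\<lambda>h. if h \<in> H then component h x else undefined"
  have supp: "{h \<in> H. ?c h \<noteq> \<zero>\<^bsub>R\<^esub>} = support x"
    using x(2) H unfolding support_def by auto
  have c: "?c \<in> fin_supp_families R A H"
    unfolding fin_supp_families_def mem_Collect_eq supp
    using component_in_A H x(1) finite_support by (auto simp: PiE_def extensional_def)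
  have "family_sum R H ?c = finsum R (\<lambda>h. component h x) (support x)"
    unfolding family_sum_def supp
    by (rule R.add.finprod_cong')
      (use x support_subset component_carrier in \<open>auto simp: subset_iff\<close>)
  also have "\<dots> = x" using finsum_components x by blast
  finally have "x = family_sum R H ?c" by (rule sym)
  then show "x \<in> graded_part R A H" unfolding graded_part_def using c by (rule image_eqI)
qed

lemma A_subset_graded_part:
  assumes "H \<subseteq> carrier G" "g \<in> H"
  shows "A g \<subseteq> graded_part R A H"
  using assms component_homogeneous A_carrier
  unfolding graded_part_eq[OF assms(1)] support_def by (auto split: if_splits)

lemma graded_part_singleton:
  assumes g: "g \<in> carrier G"
  shows "graded_part R A {g} = A g"
proof (intro equalityI subsetI)
  show "x \<in> graded_part R A {g}" if "x \<in> A g" for x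
    using A_subset_graded_part[of "{g}" g] g that by auto
  show "x \<in> A g" if "x \<in> graded_part R A {g}" for x
  proof -
    have x: "x \<in> carrier R" "support x \<subseteq> {g}" using that graded_part_eq[of "{g}"] g by auto
    have "x = finsum R (\<lambda>h. component h x) {g}"
      using finsum_components_superset[of x "{g}"] x g by simp
    also have "\<dots> = component g x" using component_carrier[OF g x(1)] by simp
    finally show ?thesis using component_in_A[OF g x(1)] by simp
  qed
qed

lemma graded_part_empty: "graded_part R A {} = {\<zero>\<^bsub>R\<^esub>}"
  using graded_part_eq[of "{}"] support_empty_iff by auto

lemma sub_bimodule_graded_part:
  assumes H: "H \<subseteq> carrier G"
  shows "sub_bimodule R (A \<one>) (graded_part R A H)"
proof -
  have eq: "graded_part R A H =
      {x \<in> carrier R. \<forall>g \<in> carrier G - H. component g x = \<zero>\<^bsub>R\<^esub>}"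
    unfolding graded_part_eq[OF H] support_def by auto
  show ?thesis
    by (rule R.sub_bimoduleI)
      (use A_one_subset in \<open>auto simp: eq component_zero component_add component_minus component_scale\<close>)
qed

text \<open>
  Injectivity of \<open>H \<mapsto> R\<^sub>H\<close> follows from this by antisymmetry. The hypothesis cannot be dropped:
  adding a degree with zero component to \<open>H\<close> does not change \<open>R\<^sub>H\<close>.
\<close>

lemma graded_part_subset_iff:
  assumes nz: "\<And>g. g \<in> carrier G \<Longrightarrow> A g \<noteq> {\<zero>\<^bsub>R\<^esub>}"
    and S: "S \<subseteq> carrier G" and T: "T \<subseteq> carrier G"
  shows "graded_part R A S \<subseteq> graded_part R A T \<longleftrightarrow> S \<subseteq> T"
proof
  assume "S \<subseteq> T"
  then show "graded_part R A S \<subseteq> graded_part R A T" using graded_part_eq S T by auto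
next
  assume sub: "graded_part R A S \<subseteq> graded_part R A T"
  show "S \<subseteq> T"
  proof
    fix g assume g: "g \<in> S"
    then have gG: "g \<in> carrier G" using S by blast
    obtain x where x: "x \<in> A g" "x \<noteq> \<zero>\<^bsub>R\<^esub>" using nz[OF gG] zero_in_A[OF gG] by blast
    have "x \<in> graded_part R A T" using A_subset_graded_part[OF S g] x sub by blast
    moreover have "g \<in> support x" using component_homogeneous[OF gG gG x(1)] x gG by (simp add: support_def)
    ultimately show "g \<in> T" using graded_part_eq[OF T] by blast
  qed
qed

section \<open>Sub-bimodules of a multiplicity-free graded ring\<close>

text \<open>
  Induction on the size of the support of \<open>x\<close>. If \<open>N\<close> contains a non-zero \<open>y\<close> of strictly smaller
  support, then \<open>N\<close> contains \<open>A h\<close> for some \<open>h\<close> in the support of \<open>y\<close>; if \<open>g \<noteq> h\<close>, subtracting the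
  degree \<open>h\<close> part of \<open>x\<close> leaves an element of \<open>N\<close> with smaller support that still involves \<open>g\<close>. If
  there is no such \<open>y\<close>, every non-zero element of \<open>N \<inter> R\<^sub>F\<close>, with \<open>F\<close> the support of \<open>x\<close>, has full
  support \<open>F\<close>, so all projections of \<open>N \<inter> R\<^sub>F\<close> to degrees in \<open>F\<close> are isomorphisms. Then \<open>F\<close> has only
  one element, and \<open>N \<inter> R\<^sub>F\<close> is a non-zero sub-bimodule of \<open>A g\<close>.
\<close>

lemma component_contained:
  assumes simple: "\<And>g. g \<in> carrier G \<Longrightarrow> simple_bimodule R (A \<one>) (A g)"
    and iso: "\<And>g h. \<lbrakk>g \<in> carrier G; h \<in> carrier G; bimodule_isomorphic R (A \<one>) (A g) (A h)\<rbrakk> \<Longrightarrow> g = h"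
    and N: "sub_bimodule R (A \<one>) N"
  shows "\<lbrakk>x \<in> N; g \<in> support x\<rbrakk> \<Longrightarrow> A g \<subseteq> N"
proof (induction "card (support x)" arbitrary: x g rule: less_induct)
  case less
  note n = R.sub_bimodule_memD[OF N]
  have xR: "x \<in> carrier R" using n less.prems by blast
  have fin: "finite (support x)" using finite_support xR .
  have gG: "g \<in> carrier G" using less.prems(2) support_subset by blast
  show ?case
  proof (cases "\<exists>y\<in>N. y \<noteq> \<zero>\<^bsub>R\<^esub> \<and> support y \<subset> support x")
    case True
    then obtain y where y: "y \<in> N" "y \<noteq> \<zero>\<^bsub>R\<^esub>" "support y \<subset> support x" by blast
    then obtain h where h: "h \<in> support y" using support_empty_iff n(1) by blast
    have hG: "h \<in> carrier G" using h support_subset by blast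
    have AhN: "A h \<subseteq> N" using less.hyps[OF _ y(1) h] psubset_card_mono[OF fin y(3)] .
    show ?thesis
    proof (cases "g = h")
      case True
      then show ?thesis using AhN by simp
    next
      case False
      let ?z = "x \<oplus>\<^bsub>R\<^esub> \<ominus>\<^bsub>R\<^esub> component h x"
      have chx: "component h x \<in> A h" "component h x \<in> carrier R"
        using component_in_A component_carrier hG xR by auto
      have zN: "?z \<in> N" using n AhN chx(1) less.prems(1) by blast
      have cz: "component k ?z = (if k = h then \<zero>\<^bsub>R\<^esub> else component k x)" if k: "k \<in> carrier G" for k
        using component_add[OF k xR] component_minus[OF k chx(2)] chx(2)
          component_homogeneous[OF k hG chx(1)] component_carrier[OF k xR]
        by (auto simp: R.r_neg)
      have "support ?z = support x - {h}" unfolding support_def using cz by (auto split: if_splits)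
      moreover have "h \<in> support x" using h y(3) by blast
      ultimately have sz: "support ?z \<subset> support x" "g \<in> support ?z"
        using False less.prems(2) by auto
      show ?thesis by (rule less.hyps[OF psubset_card_mono[OF fin sz(1)] zN sz(2)])
    qed
  next
    case False
    define M where "M = N \<inter> graded_part R A (support x)"
    have M: "sub_bimodule R (A \<one>) M"
      unfolding M_def using R.sub_bimodule_Int N sub_bimodule_graded_part support_subset by blast
    have xM: "x \<in> M" unfolding M_def using less.prems(1) xR graded_part_eq[OF support_subset] by blast
    have full: "support y = support x" if "y \<in> M" "y \<noteq> \<zero>\<^bsub>R\<^esub>" for y
      using that False graded_part_eq[OF support_subset] unfolding M_def by blast
    have isoM: "bimodule_isomorphic R (A \<one>) M (A k)" if k: "k \<in> support x" for k
    proof -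
      have kG: "k \<in> carrier G" using k support_subset by blast
      have hom: "bimodule_hom R (A \<one>) M (A k) (component k)"
        using bimodule_hom_subset[OF component_hom[OF kG]] R.sub_bimodule_memD(1)[OF M] by blast
      have "inj_on (component k) M"
        by (rule R.bimodule_hom_inj_on[OF M sub_bimodule_A[OF kG] hom])
          (use full k in \<open>auto simp: support_def\<close>)
      moreover have "component k ` M = A k"
        by (rule R.simple_bimodule_hom_onto[OF M simple[OF kG] hom xM])
          (use k in \<open>simp add: support_def\<close>)
      ultimately show ?thesis
        using hom unfolding bimodule_isomorphic_iff_bij_hom bij_betw_def by blast
    qed
    have "k = g" if k: "k \<in> support x" for k
    proof -
      have "bimodule_isomorphic R (A \<one>) (A k) (A g)"
        by (rule bimodule_isomorphic_trans[OF R.bimodule_isomorphic_sym[OF M isoM[OF k]]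
              isoM[OF less.prems(2)]])
      then show ?thesis using iso k gG support_subset by blast
    qed
    then have "support x = {g}" using less.prems(2) by blast
    then have MA: "M = N \<inter> A g" unfolding M_def using graded_part_singleton[OF gG] by simp
    have "x \<noteq> \<zero>\<^bsub>R\<^esub>" using less.prems(2) support_empty_iff[OF xR] by blast
    then have "M = A g"
      using simple[OF gG] M MA xM unfolding simple_bimodule_def by blast
    then show ?thesis using MA by blast
  qed
qed

lemma sub_bimodule_eq_graded_part:
  assumes simple: "\<And>g. g \<in> carrier G \<Longrightarrow> simple_bimodule R (A \<one>) (A g)"
    and iso: "\<And>g h. \<lbrakk>g \<in> carrier G; h \<in> carrier G; bimodule_isomorphic R (A \<one>) (A g) (A h)\<rbrakk> \<Longrightarrow> g = h"
    and N: "sub_bimodule R (A \<one>) N"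
  shows "N = graded_part R A {g \<in> carrier G. A g \<subseteq> N}"
proof -
  note n = R.sub_bimodule_memD[OF N]
  let ?H = "{g \<in> carrier G. A g \<subseteq> N}"
  have eq: "graded_part R A ?H = {x \<in> carrier R. support x \<subseteq> ?H}"
    by (rule graded_part_eq) blast
  have sum_in: "finite F \<Longrightarrow> (\<And>h. h \<in> F \<Longrightarrow> c h \<in> N) \<Longrightarrow> finsum R c F \<in> N" for F :: "'g set" and c
  proof (induction F rule: finite_induct)
    case empty
    then show ?case using n by simp
  next
    case (insert h F)
    then have "finsum R c (insert h F) = c h \<oplus>\<^bsub>R\<^esub> finsum R c F"
      by (intro R.finsum_insert) (auto intro: n(1))
    then show ?case using insert n(3) by simp
  qed
  show ?thesis
    unfolding eq
  proof (intro equalityI subsetI)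
    fix x assume x: "x \<in> N"
    show "x \<in> {x \<in> carrier R. support x \<subseteq> ?H}"
      using component_contained[OF simple iso N x] n(1)[OF x] support_subset by blast
  next
    fix x assume "x \<in> {x \<in> carrier R. support x \<subseteq> ?H}"
    then have x: "x \<in> carrier R" "support x \<subseteq> ?H" by auto
    have "finsum R (\<lambda>h. component h x) (support x) \<in> N"
      by (rule sum_in[OF finite_support[OF x(1)]]) (use x component_in_A in blast)
    then show "x \<in> N" using finsum_components x by simp
  qed
qed

text \<open>
  For \<open>g \<in> S\<close>, an isomorphism \<open>R\<^sub>S \<rightarrow> R\<^sub>T\<close> does not vanish on \<open>A g\<close>, so it stays non-zero after
  projection to some degree \<open>h \<in> T\<close>. Schur's lemma then gives \<open>A g \<cong> A h\<close>, whence \<open>g = h\<close>.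
\<close>

lemma graded_part_isomorphic_imp_subset:
  assumes simple: "\<And>g. g \<in> carrier G \<Longrightarrow> simple_bimodule R (A \<one>) (A g)"
    and iso: "\<And>g h. \<lbrakk>g \<in> carrier G; h \<in> carrier G; bimodule_isomorphic R (A \<one>) (A g) (A h)\<rbrakk> \<Longrightarrow> g = h"
    and S: "S \<subseteq> carrier G" and T: "T \<subseteq> carrier G"
    and ST: "bimodule_isomorphic R (A \<one>) (graded_part R A S) (graded_part R A T)"
  shows "S \<subseteq> T"
proof
  fix g assume g: "g \<in> S"
  then have gG: "g \<in> carrier G" using S by blast
  obtain f where f: "bimodule_hom R (A \<one>) (graded_part R A S) (graded_part R A T) f"
    and bij: "bij_betw f (graded_part R A S) (graded_part R A T)"
    using ST unfolding bimodule_isomorphic_iff_bij_hom by blast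
  note Sb = sub_bimodule_graded_part[OF S] and Tb = sub_bimodule_graded_part[OF T]
  have AS: "A g \<subseteq> graded_part R A S" using A_subset_graded_part[OF S g] .
  obtain x where x: "x \<in> A g" "x \<noteq> \<zero>\<^bsub>R\<^esub>"
    using simple[OF gG] zero_in_A[OF gG] unfolding simple_bimodule_def by blast
  have fx: "f x \<in> graded_part R A T" using bimodule_hom_closed[OF f subsetD[OF AS x(1)]] .
  have "f x \<noteq> f \<zero>\<^bsub>R\<^esub>"
    using inj_onD[OF bij_betw_imp_inj_on[OF bij] _ subsetD[OF AS x(1)] R.sub_bimodule_memD(2)[OF Sb]]
      x(2) by blast
  then have "f x \<noteq> \<zero>\<^bsub>R\<^esub>" using R.bimodule_hom_zero[OF Sb Tb f] by simp
  then obtain h where h: "h \<in> support (f x)"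
    using support_empty_iff[OF R.sub_bimodule_memD(1)[OF Tb fx]] by blast
  have hT: "h \<in> T" and hG: "h \<in> carrier G" using h fx graded_part_eq[OF T] T by auto
  have fA: "bimodule_hom R (A \<one>) (A g) (graded_part R A T) f"
    using bimodule_hom_subset[OF f AS] .
  have cT: "bimodule_hom R (A \<one>) (graded_part R A T) (A h) (component h)"
    using bimodule_hom_subset[OF component_hom[OF hG]] R.sub_bimodule_memD(1)[OF Tb] by blast
  have "bimodule_isomorphic R (A \<one>) (A g) (A h)"
    by (rule R.simple_bimodules_isomorphic[OF A_one_subset simple[OF gG] simple[OF hG]
          bimodule_hom_comp[OF fA cT] x(1)])
      (use h in \<open>simp add: support_def\<close>)
  then show "g \<in> T" using iso[OF gG hG] hT by blast
qed

section \<open>Controlled gradations\<close>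

lemma controlled_imp_simple:
  assumes con: "controlled G R A" and g: "g \<in> carrier G"
  shows "simple_bimodule R (A \<one>) (A g)"
proof -
  have bij: "bij_betw (graded_part R A) (Pow (carrier G)) {M. sub_bimodule R (A \<one>) M}"
    using con unfolding controlled_def by blast
  \<comment> \<open>A zero component would make \<open>R\<^sub>H\<close> the same for \<open>H = {h}\<close> and for empty \<open>H\<close>.\<close>
  have nz: "A h \<noteq> {\<zero>\<^bsub>R\<^esub>}" if h: "h \<in> carrier G" for h
  proof
    assume "A h = {\<zero>\<^bsub>R\<^esub>}"
    then have "graded_part R A {h} = graded_part R A {}"
      using graded_part_singleton[OF h] graded_part_empty by simp
    then have "{h} = ({} :: 'g set)"
      using inj_onD[OF bij_betw_imp_inj_on[OF bij], of "{h}" "{}"] h by blast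
    then show False by blast
  qed
  have "N = {\<zero>\<^bsub>R\<^esub>} \<or> N = A g" if N: "sub_bimodule R (A \<one>) N" "N \<subseteq> A g" for N
  proof -
    obtain H where H: "H \<subseteq> carrier G" "N = graded_part R A H"
      using bij N(1) unfolding bij_betw_def by blast
    then have "H \<subseteq> {g}"
      using graded_part_subset_iff[OF nz, of H "{g}"] graded_part_singleton[OF g] N(2) g by simp
    then have "H = {} \<or> H = {g}" by blast
    then show ?thesis using H(2) graded_part_empty graded_part_singleton[OF g] by blast
  qed
  then show ?thesis unfolding simple_bimodule_def using sub_bimodule_A[OF g] nz[OF g] by blast
qed

lemma controlled_imp_isomorphic_iff:
  assumes con: "controlled G R A" and g: "g \<in> carrier G" and h: "h \<in> carrier G"
  shows "bimodule_isomorphic R (A \<one>) (A g) (A h) \<longleftrightarrow> g = h"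
proof -
  have "bimodule_isomorphic R (A \<one>) (graded_part R A {g}) (graded_part R A {h}) \<longleftrightarrow> {g} = {h}"
    by (rule con[unfolded controlled_def, THEN conjunct2, rule_format]) (use g h in simp)
  then show ?thesis using graded_part_singleton g h by simp
qed

lemma simple_nonisomorphic_imp_controlled:
  assumes simple: "\<And>g. g \<in> carrier G \<Longrightarrow> simple_bimodule R (A \<one>) (A g)"
    and iso: "\<And>g h. \<lbrakk>g \<in> carrier G; h \<in> carrier G; bimodule_isomorphic R (A \<one>) (A g) (A h)\<rbrakk> \<Longrightarrow> g = h"
  shows "controlled G R A"
  unfolding controlled_def
proof (intro conjI allI impI)
  have nz: "A h \<noteq> {\<zero>\<^bsub>R\<^esub>}" if "h \<in> carrier G" for h
    using simple[OF that] unfolding simple_bimodule_def by blast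
  have "inj_on (graded_part R A) (Pow (carrier G))"
  proof (rule inj_onI)
    fix S T assume "S \<in> Pow (carrier G)" "T \<in> Pow (carrier G)" "graded_part R A S = graded_part R A T"
    then show "S = T"
      using graded_part_subset_iff[OF nz, of S T] graded_part_subset_iff[OF nz, of T S] by auto
  qed
  moreover have "graded_part R A ` Pow (carrier G) = {M. sub_bimodule R (A \<one>) M}"
  proof (intro equalityI subsetI)
    show "M \<in> {M. sub_bimodule R (A \<one>) M}" if "M \<in> graded_part R A ` Pow (carrier G)" for M
      using that sub_bimodule_graded_part by blast
    show "M \<in> graded_part R A ` Pow (carrier G)" if "M \<in> {M. sub_bimodule R (A \<one>) M}" for M
    proof (rule image_eqI)
      show "M = graded_part R A {g \<in> carrier G. A g \<subseteq> M}"
        by (rule sub_bimodule_eq_graded_part[OF simple iso]) (use that in auto)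
    qed blast
  qed
  ultimately show "bij_betw (graded_part R A) (Pow (carrier G)) {M. sub_bimodule R (A \<one>) M}"
    unfolding bij_betw_def by blast
next
  fix S T assume "S \<subseteq> carrier G \<and> T \<subseteq> carrier G"
  then have S: "S \<subseteq> carrier G" and T: "T \<subseteq> carrier G" by auto
  show "bimodule_isomorphic R (A \<one>) (graded_part R A S) (graded_part R A T) \<longleftrightarrow> S = T"
  proof
    assume ST: "bimodule_isomorphic R (A \<one>) (graded_part R A S) (graded_part R A T)"
    have TS: "bimodule_isomorphic R (A \<one>) (graded_part R A T) (graded_part R A S)"
      using R.bimodule_isomorphic_sym[OF sub_bimodule_graded_part[OF S] ST] .
    show "S = T"
      using graded_part_isomorphic_imp_subset[OF simple iso S T ST]
        graded_part_isomorphic_imp_subset[OF simple iso T S TS] by blast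
  next
    assume "S = T"
    then show "bimodule_isomorphic R (A \<one>) (graded_part R A S) (graded_part R A T)"
      using bimodule_isomorphic_refl by blast
  qed
qed

end

theorem theorem3p5:
  fixes G :: "('g, 'm) monoid_scheme"
    and R :: "('a, 'n) ring_scheme"
    and A :: "'g \<Rightarrow> 'a set"
  assumes "graded_ring G R A"
  shows "controlled G R A \<longleftrightarrow>
    (\<forall>g\<in>carrier G. simple_bimodule R (A \<one>\<^bsub>G\<^esub>) (A g)) \<and>
    (\<forall>g\<in>carrier G. \<forall>h\<in>carrier G.
       bimodule_isomorphic R (A \<one>\<^bsub>G\<^esub>) (A g) (A h) \<longleftrightarrow> g = h)"
proof -
  interpret graded_ring G R A using assms .
  show ?thesis (is "_ \<longleftrightarrow> ?simple \<and> ?iso")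
  proof
    assume con: "controlled G R A"
    show "?simple \<and> ?iso"
      by (intro conjI ballI controlled_imp_simple[OF con] controlled_imp_isomorphic_iff[OF con])
  next
    assume conds: "?simple \<and> ?iso"
    show "controlled G R A"
    proof (rule simple_nonisomorphic_imp_controlled)
      show "simple_bimodule R (A \<one>\<^bsub>G\<^esub>) (A g)" if "g \<in> carrier G" for g
        using bspec[OF conjunct1[OF conds] that] .
      show "g = h" if "g \<in> carrier G" "h \<in> carrier G"
        "bimodule_isomorphic R (A \<one>\<^bsub>G\<^esub>) (A g) (A h)" for g h
        using bspec[OF bspec[OF conjunct2[OF conds] that(1)] that(2)] that(3) by (rule iffD1)
    qed
  qed
qed

end
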